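(* Let $k\ge 0$ be an integer. If $G$ is a semi-arc $k$-visibility graph, then its chromatic number satisfies $\chi(G)\le 4k+4$.
   Context: All arcs are arcs of circles centered at the origin of the plane. An arc is a set given in polar coordinates by $\{(r,\alpha):\alpha_1\le\alpha\le\alpha_2\}$ with $r>0$, $\alpha_1\in[0,2\pi)$ and $0\le\alpha_2-\alpha_1<2\pi$; the points $(r,\alpha_1)$ and $(r,\alpha_2)$ are its negative and positive endpoints. A (non-degenerate) cone is a 4-sided region of positive area with two opposite sides being arcs of circles centered at the origin and the other two sides being (possibly intersecting) radial line segments. So a cone is either a region $\{(r,\alpha): r_1\le r\le r_2,\ \theta_1\le\alpha\le\theta_2\}$ or a "bow-tie" region through the origin, $\{(r,\alpha):0\le r\le r_1,\ \theta_1\le\alpha\le\theta_2\}\cup\{(r,\alpha):0\le r\le r_2,\ \theta_1+\pi\le\alpha\le\theta_2+\pi\}$; in particular, visibility through the origin is allowed. The two circular sides are called the circular ends of the cone. An arc $k$-visibility graph is a finite graph whose vertices can be represented by pairwise disjoint arcs such that two distinct vertices are adjacent if and only if there is a cone whose two circular ends are subsets of the two corresponding arcs, one in each, and which intersects at most $k$ arcs of the representation other than these two. A semi-arc $k$-visibility graph is an arc $k$-visibility graph having such a representation in which the negative endpoint of every arc lies on the positive $x$-axis (i.e. $\alpha_1=0$ for every arc). *)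

theory Defs
  imports Complex_Main "Graph_Theory.Graph_Theory"
begin

text \<open>
  The plane is the type \<^typ>\<open>complex\<close>, and the point with polar coordinates $(r,\alpha)$
  is \<^term>\<open>rcis r \<alpha>\<close>.
\<close>

definition arc_points :: "real \<Rightarrow> real \<Rightarrow> real \<Rightarrow> complex set" where
  "arc_points r \<alpha>\<^sub>1 \<alpha>\<^sub>2 = {rcis r \<alpha> | \<alpha>. \<alpha>\<^sub>1 \<le> \<alpha> \<and> \<alpha> \<le> \<alpha>\<^sub>2}"

definition sector_points :: "real \<Rightarrow> real \<Rightarrow> real \<Rightarrow> real \<Rightarrow> complex set" where
  "sector_points r\<^sub>1 r\<^sub>2 \<theta>\<^sub>1 \<theta>\<^sub>2 =
     {rcis r \<alpha> | r \<alpha>. r\<^sub>1 \<le> r \<and> r \<le> r\<^sub>2 \<and> \<theta>\<^sub>1 \<le> \<alpha> \<and> \<alpha> \<le> \<theta>\<^sub>2}"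

datatype circ_arc = Circ_Arc (radius: real) (neg_angle: real) (pos_angle: real)

definition valid_arc :: "circ_arc \<Rightarrow> bool" where
  "valid_arc A \<longleftrightarrow> 0 < radius A \<and> 0 \<le> neg_angle A \<and> neg_angle A < 2 * pi \<and>
     0 \<le> pos_angle A - neg_angle A \<and> pos_angle A - neg_angle A < 2 * pi"

definition arc_set :: "circ_arc \<Rightarrow> complex set" where
  "arc_set A = arc_points (radius A) (neg_angle A) (pos_angle A)"

text \<open>
  \<open>cone C S T\<close> says that \<open>C\<close> is a cone with circular ends \<open>S\<close> and \<open>T\<close>. The strict inequalities
  express positive area together with the requirement that \<open>S\<close> and \<open>T\<close> are arcs (positive radius,
  angular width less than $2\pi$).
  A bow-tie of width at least $\pi$ overlaps itself. Admitting it is harmless: any bow-tie contains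
  narrower ones, whose ends are contained in its ends and which meet no further arcs, so
  the visibility relation below is not affected.
\<close>

inductive cone :: "complex set \<Rightarrow> complex set \<Rightarrow> complex set \<Rightarrow> bool" where
  annular:
    "\<lbrakk>0 < r\<^sub>1; r\<^sub>1 < r\<^sub>2; \<theta>\<^sub>1 < \<theta>\<^sub>2; \<theta>\<^sub>2 < \<theta>\<^sub>1 + 2 * pi\<rbrakk> \<Longrightarrow>
     cone (sector_points r\<^sub>1 r\<^sub>2 \<theta>\<^sub>1 \<theta>\<^sub>2) (arc_points r\<^sub>1 \<theta>\<^sub>1 \<theta>\<^sub>2) (arc_points r\<^sub>2 \<theta>\<^sub>1 \<theta>\<^sub>2)"
| bow_tie:
    "\<lbrakk>0 < r\<^sub>1; 0 < r\<^sub>2; \<theta>\<^sub>1 < \<theta>\<^sub>2; \<theta>\<^sub>2 < \<theta>\<^sub>1 + 2 * pi\<rbrakk> \<Longrightarrow>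
     cone (sector_points 0 r\<^sub>1 \<theta>\<^sub>1 \<theta>\<^sub>2 \<union> sector_points 0 r\<^sub>2 (\<theta>\<^sub>1 + pi) (\<theta>\<^sub>2 + pi))
       (arc_points r\<^sub>1 \<theta>\<^sub>1 \<theta>\<^sub>2) (arc_points r\<^sub>2 (\<theta>\<^sub>1 + pi) (\<theta>\<^sub>2 + pi))"

text \<open>
  Finite simple graphs are \<^term>\<open>pair_graph G\<close>: finite, symmetric, loop-free pair digraphs.
  Note that \<^term>\<open>parcs G\<close> is the (symmetric) adjacency relation and is unrelated
  to the circular arcs.
\<close>

definition k_visible :: "nat \<Rightarrow> 'a set \<Rightarrow> ('a \<Rightarrow> circ_arc) \<Rightarrow> 'a \<Rightarrow> 'a \<Rightarrow> bool" where
  "k_visible k V f u v \<longleftrightarrow>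
     (\<exists>C S T. cone C S T \<and>
        (S \<subseteq> arc_set (f u) \<and> T \<subseteq> arc_set (f v) \<or> S \<subseteq> arc_set (f v) \<and> T \<subseteq> arc_set (f u)) \<and>
        card {w \<in> V - {u, v}. C \<inter> arc_set (f w) \<noteq> {}} \<le> k)"

definition arc_visibility_rep :: "nat \<Rightarrow> 'a pair_pre_digraph \<Rightarrow> ('a \<Rightarrow> circ_arc) \<Rightarrow> bool" where
  "arc_visibility_rep k G f \<longleftrightarrow>
     (\<forall>v\<in>pverts G. valid_arc (f v)) \<and>
     pairwise (\<lambda>u v. disjnt (arc_set (f u)) (arc_set (f v))) (pverts G) \<and>
     (\<forall>u\<in>pverts G. \<forall>v\<in>pverts G. u \<noteq> v \<longrightarrow>
        ((u, v) \<in> parcs G \<longleftrightarrow> k_visible k (pverts G) f u v))"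

definition arc_visibility_graph :: "nat \<Rightarrow> 'a pair_pre_digraph \<Rightarrow> bool" where
  "arc_visibility_graph k G \<longleftrightarrow> pair_graph G \<and> (\<exists>f. arc_visibility_rep k G f)"

definition semi_arc_visibility_graph :: "nat \<Rightarrow> 'a pair_pre_digraph \<Rightarrow> bool" where
  "semi_arc_visibility_graph k G \<longleftrightarrow> arc_visibility_graph k G \<and>
     (\<exists>f. arc_visibility_rep k G f \<and> (\<forall>v\<in>pverts G. neg_angle (f v) = 0))"

definition proper_coloring :: "'a pair_pre_digraph \<Rightarrow> nat \<Rightarrow> ('a \<Rightarrow> nat) \<Rightarrow> bool" where
  "proper_coloring G n c \<longleftrightarrow>
     (\<forall>v\<in>pverts G. c v < n) \<and> (\<forall>(u, v)\<in>parcs G. c u \<noteq> c v)"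

definition chromatic_number :: "'a pair_pre_digraph \<Rightarrow> nat" where
  "chromatic_number G = (LEAST n. \<exists>c. proper_coloring G n c)"

text \<open>The least such number exists, so \<open>LEAST\<close> is never applied to an unsatisfiable predicate.\<close>

lemma ex_proper_coloring_chromatic_number:
  assumes "pair_graph G"
  shows "\<exists>c. proper_coloring G (chromatic_number G) c"
proof -
  interpret pair_graph G by (rule assms)
  obtain c :: "'a \<Rightarrow> nat" where c: "bij_betw c (pverts G) {0..<card (pverts G)}"
    using ex_bij_betw_finite_nat[OF pair_finite_verts] by blast
  have "c v < card (pverts G)" if "v \<in> pverts G" for v
    using bij_betw_apply[OF c that] by simp
  moreover have "c u \<noteq> c v" if "(u, v) \<in> parcs G" for u v
    using inj_on_eq_iff[OF bij_betw_imp_inj_on[OF c] in_arcsD1[OF that] in_arcsD2[OF that]]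
      pair_no_loops[OF that] by simp
  ultimately have "proper_coloring G (card (pverts G)) c"
    unfolding proper_coloring_def by blast
  then have "\<exists>n c. proper_coloring G n c"
    by blast
  then show ?thesis
    unfolding chromatic_number_def by (rule LeastI_ex)
qed

end

theory Submission
  imports Defs
begin

text \<open>
  Every arc starts at angle $0$, so rotating a line of sight counterclockwise only removes arcs from
  it. Hence each line of sight can be rotated until it meets the positive endpoint of one of the two
  arcs that see each other. From the positive endpoint of an arc, at most $k+1$ arcs are seen
  along the ray leaving outwards, and at most $k+1$ along the ray running inwards and
  through the origin. The outermost arc sees nothing outwards, so every nonempty subset $W$ of the
  vertices induces fewer than $(2k+2)|W|$ edges. Some vertex of $W$ therefore has degree at most
  $4k+3$ in $W$, and greedy coloring needs only $4k+4$ colors.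
\<close>

section \<open>Coloring degenerate graphs\<close>

text \<open>The hypothesis on all nonempty subsets is hereditary, so a vertex with fewer than
  \<open>d\<close> neighbors can be removed and the rest colored by induction; the neighbors cannot
  use up all \<open>d\<close> colors.\<close>

lemma degenerate_coloring:
  assumes "finite V"
    and sym: "\<And>u v. R u v \<Longrightarrow> R v u"
    and deg: "\<And>W. W \<subseteq> V \<Longrightarrow> W \<noteq> {} \<Longrightarrow> \<exists>u\<in>W. card {v \<in> W. R u v} < d"
  shows "\<exists>c :: 'a \<Rightarrow> nat. (\<forall>v\<in>V. c v < d) \<and> (\<forall>u\<in>V. \<forall>v\<in>V. u \<noteq> v \<longrightarrow> R u v \<longrightarrow> c u \<noteq> c v)"
  using assms(1) deg
proof (induction "card V" arbitrary: V)
  case 0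
  then show ?case by simp
next
  case (Suc n)
  then have "V \<noteq> {}" by auto
  with Suc.prems(2) obtain x where x: "x \<in> V" "card {v \<in> V. R x v} < d" by blast
  have "n = card (V - {x})" using Suc.hyps(2) x Suc.prems(1) by simp
  moreover have "\<exists>u\<in>W. card {v \<in> W. R u v} < d" if "W \<subseteq> V - {x}" "W \<noteq> {}" for W
    using Suc.prems(2)[of W] that by blast
  ultimately obtain c :: "'a \<Rightarrow> nat" where c: "\<forall>v\<in>V - {x}. c v < d"
    "\<forall>u\<in>V - {x}. \<forall>v\<in>V - {x}. u \<noteq> v \<longrightarrow> R u v \<longrightarrow> c u \<noteq> c v"
    using Suc.hyps(1)[of "V - {x}"] Suc.prems(1) by blast
  have "card (c ` {v \<in> V. R x v}) < card {..<d}"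
    using card_image_le[of "{v \<in> V. R x v}" c] Suc.prems(1) x(2) by simp
  then have "\<not> {..<d} \<subseteq> c ` {v \<in> V. R x v}"
    using card_mono[of "c ` {v \<in> V. R x v}" "{..<d}"] Suc.prems(1) by auto
  then obtain e where e: "e < d" "e \<notin> c ` {v \<in> V. R x v}" by blast
  have "\<forall>v\<in>V. (c(x := e)) v < d" using c(1) e(1) by simp
  moreover have "(c(x := e)) u \<noteq> (c(x := e)) v"
    if "u \<in> V" "v \<in> V" "u \<noteq> v" "R u v" for u v
    using that c(2) e(2) sym[OF that(4)] by (auto simp: image_iff)
  ultimately show ?case by blast
qed

text \<open>Read \<open>N\<close> as an orientation: every edge inside \<open>W\<close> lies in the
  out-set of one of its ends. In- and out-degrees have the same total, so the degrees sum to less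
  than \<open>2 * d * card W\<close>.\<close>

lemma sparse_orientation_low_degree:
  assumes "finite W" and "(\<Sum>u\<in>W. card (N u \<inter> W)) < d * card W"
    and edge: "\<And>u v. u \<in> W \<Longrightarrow> v \<in> W \<Longrightarrow> R u v \<Longrightarrow> v \<in> N u \<or> u \<in> N v"
  shows "\<exists>u\<in>W. card {v \<in> W. R u v} < 2 * d"
proof (rule ccontr)
  assume "\<not> ?thesis"
  then have "(\<Sum>u\<in>W. 2 * d) \<le> (\<Sum>u\<in>W. card {v \<in> W. R u v})"
    by (intro sum_mono) auto
  also have "\<dots> \<le> (\<Sum>u\<in>W. card (N u \<inter> W) + card {v \<in> W. u \<in> N v})"
  proof (rule sum_mono)
    fix u assume "u \<in> W"
    then have "{v \<in> W. R u v} \<subseteq> (N u \<inter> W) \<union> {v \<in> W. u \<in> N v}" using edge by blast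
    then have "card {v \<in> W. R u v} \<le> card ((N u \<inter> W) \<union> {v \<in> W. u \<in> N v})"
      using assms(1) by (intro card_mono) auto
    then show "card {v \<in> W. R u v} \<le> card (N u \<inter> W) + card {v \<in> W. u \<in> N v}"
      using card_Un_le le_trans by blast
  qed
  also have "\<dots> = (\<Sum>u\<in>W. card (N u \<inter> W)) + (\<Sum>v\<in>W. card {u \<in> W. u \<in> N v})"
    using sum_multicount_gen[OF assms(1) assms(1), of "\<lambda>v u. u \<in> N v" "\<lambda>u. card {v \<in> W. u \<in> N v}"]
    by (simp add: sum.distrib)
  also have "(\<Sum>v\<in>W. card {u \<in> W. u \<in> N v}) = (\<Sum>v\<in>W. card (N v \<inter> W))"
    by (intro sum.cong arg_cong[where f = card]) auto
  finally have "2 * (d * card W) \<le> 2 * (\<Sum>u\<in>W. card (N u \<inter> W))"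
    by (simp add: algebra_simps)
  then show False using assms(2) by simp
qed

text \<open>All elements but the one with the largest value of \<open>p\<close> lie below
  it.\<close>

lemma card_le_Suc_if_few_below:
  fixes p :: "'a \<Rightarrow> 'b::linorder"
  assumes "finite N" "inj_on p N" and few: "\<And>v. v \<in> N \<Longrightarrow> card {w \<in> N. p w < p v} \<le> k"
  shows "card N \<le> k + 1"
proof (cases "N = {}")
  case False
  with assms(1) have "Max (p ` N) \<in> p ` N" by (intro Max_in) auto
  then obtain v where v: "Max (p ` N) = p v" "v \<in> N" by (rule imageE)
  have "p w \<le> p v" if "w \<in> N" for w
    using Max_ge[of "p ` N" "p w"] assms(1) that v(1) by simp
  then have "{w \<in> N. p w < p v} = N - {v}"
    using v(2) assms(2) by (auto simp: less_le inj_on_eq_iff)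
  then show ?thesis using few[OF v(2)] v(2) assms(1) by simp
qed simp

section \<open>Lines of sight\<close>

text \<open>\<open>v\<close> has radius \<open>r v\<close> and positive angle \<open>a v\<close>.\<close>

locale semi_arcs =
  fixes k :: nat and V :: "'a set" and r a :: "'a \<Rightarrow> real"
  assumes finV: "finite V" and inj_r: "inj_on r V"
    and r_pos: "v \<in> V \<Longrightarrow> 0 < r v" and a_less: "v \<in> V \<Longrightarrow> a v < 2 * pi"
begin

text \<open>For \<phi> in [0, 2 pi), an arc starting at angle 0 meets the ray at angle \<phi>
  exactly when its positive angle is at least \<phi>. Blocking thus becomes a comparison of
  numbers.\<close>

definition ring_sight :: "real \<Rightarrow> 'a \<Rightarrow> 'a \<Rightarrow> bool" where
  "ring_sight \<phi> u v \<longleftrightarrow> \<phi> \<le> a u \<and> \<phi> \<le> a v \<and> r u < r v \<and>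
     card {w \<in> V - {u, v}. r u < r w \<and> r w < r v \<and> \<phi> \<le> a w} \<le> k"

text \<open>The two halves of the line carry separate angles, so that either may be the larger one.
  The ends \<open>u\<close> and \<open>v\<close> are not counted even where they meet the line a
  second time.\<close>

definition origin_sight :: "real \<Rightarrow> real \<Rightarrow> 'a \<Rightarrow> 'a \<Rightarrow> bool" where
  "origin_sight \<phi> \<psi> u v \<longleftrightarrow> \<phi> \<le> a u \<and> \<psi> \<le> a v \<and>
     card {w \<in> V - {u, v}. r w < r u \<and> \<phi> \<le> a w \<or> r w < r v \<and> \<psi> \<le> a w} \<le> k"

text \<open>Angles from [0, 2 pi) stay in that range, where they can be compared with
  \<open>a\<close>.\<close>

definition opposite :: "real \<Rightarrow> real" where
  "opposite \<phi> = (if \<phi> < pi then \<phi> + pi else \<phi> - pi)"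

definition out_sight :: "'a \<Rightarrow> 'a set" where
  "out_sight u = {v \<in> V - {u}. ring_sight (a u) u v}"

definition in_sight :: "'a \<Rightarrow> 'a set" where
  "in_sight u = {v \<in> V - {u}. ring_sight (a u) v u \<or> origin_sight (a u) (opposite (a u)) u v}"

section \<open>Rotating a line of sight to a positive endpoint\<close>

lemma origin_sight_commute: "origin_sight \<phi> \<psi> u v \<longleftrightarrow> origin_sight \<psi> \<phi> v u"
  unfolding origin_sight_def by (auto simp: insert_commute disj_commute)

lemma ring_sight_mono:
  assumes "ring_sight \<phi> u v" "\<phi> \<le> \<phi>'" "\<phi>' \<le> a u" "\<phi>' \<le> a v"
  shows "ring_sight \<phi>' u v"
proof -
  have "card {w \<in> V - {u, v}. r u < r w \<and> r w < r v \<and> \<phi>' \<le> a w}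
      \<le> card {w \<in> V - {u, v}. r u < r w \<and> r w < r v \<and> \<phi> \<le> a w}"
    using assms(2) finV by (intro card_mono) auto
  then show ?thesis using assms unfolding ring_sight_def by linarith
qed

lemma origin_sight_mono:
  assumes "origin_sight \<phi> \<psi> u v" "\<phi> \<le> \<phi>'" "\<psi> \<le> \<psi>'" "\<phi>' \<le> a u" "\<psi>' \<le> a v"
  shows "origin_sight \<phi>' \<psi>' u v"
proof -
  have "card {w \<in> V - {u, v}. r w < r u \<and> \<phi>' \<le> a w \<or> r w < r v \<and> \<psi>' \<le> a w}
      \<le> card {w \<in> V - {u, v}. r w < r u \<and> \<phi> \<le> a w \<or> r w < r v \<and> \<psi> \<le> a w}"
    using assms(2,3) finV by (intro card_mono) auto
  then show ?thesis using assms unfolding origin_sight_def by linarith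
qed

text \<open>The line turns to the smaller of \<open>a u\<close> and \<open>a v\<close>. The end that
  stops it does the looking: outwards if it is \<open>u\<close>, inwards if it is
  \<open>v\<close>.\<close>

lemma ring_sight_imp:
  assumes "u \<in> V" "v \<in> V" "ring_sight \<phi> u v"
  shows "v \<in> out_sight u \<or> u \<in> in_sight v"
proof -
  have *: "u \<noteq> v" "\<phi> \<le> a u" "\<phi> \<le> a v" using assms(3) by (auto simp: ring_sight_def)
  show ?thesis
  proof (cases "a u \<le> a v")
    case True
    then show ?thesis
      using ring_sight_mono[OF assms(3) *(2)] * assms(2) by (simp add: out_sight_def)
  next
    case False
    then show ?thesis
      using ring_sight_mono[OF assms(3) *(3)] * assms(1) by (simp add: in_sight_def)
  qed
qed

text \<open>The two halves turn together until one end stops them, \<open>u\<close> at angle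
  \<open>a u\<close> or \<open>v\<close> at \<open>a v - pi\<close>. As 0 \<le> \<phi> and
  \<open>a v < 2 * pi\<close>, neither half passes the positive x-axis on the way.\<close>

lemma origin_sight_imp:
  assumes "u \<in> V" "v \<in> V" "u \<noteq> v" "0 \<le> \<phi>" "origin_sight \<phi> (\<phi> + pi) u v"
  shows "v \<in> in_sight u \<or> u \<in> in_sight v"
proof -
  have *: "\<phi> \<le> a u" "\<phi> + pi \<le> a v" using assms(5) by (auto simp: origin_sight_def)
  show ?thesis
  proof (cases "a u + pi \<le> a v")
    case True
    have "opposite (a u) = a u + pi"
      using True a_less[OF assms(2)] by (simp add: opposite_def)
    then show ?thesis
      using origin_sight_mono[OF assms(5) *(1), of "a u + pi"] True * assms
      by (simp add: in_sight_def)
  next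
    case False
    have "opposite (a v) = a v - pi"
      using *(2) assms(4) by (simp add: opposite_def)
    then show ?thesis
      using origin_sight_mono[OF assms(5) _ *(2), of "a v - pi"] False * assms
        origin_sight_commute[of "a v - pi" "a v" u v]
      by (simp add: in_sight_def)
  qed
qed

section \<open>Counting the arcs seen from a positive endpoint\<close>

text \<open>In the order of the radii, every arc seen before \<open>v\<close> reaches angle
  \<open>a u\<close> and therefore blocks \<open>v\<close>.\<close>

lemma card_out_sight: "card (out_sight u) \<le> k + 1"
proof (rule card_le_Suc_if_few_below[where p = r])
  show "finite (out_sight u)" using finV by (simp add: out_sight_def)
  show "inj_on r (out_sight u)" using inj_r by (rule inj_on_subset) (auto simp: out_sight_def)
  fix v assume v: "v \<in> out_sight u"
  then have "{w \<in> out_sight u. r w < r v}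
      \<subseteq> {w \<in> V - {u, v}. r u < r w \<and> r w < r v \<and> a u \<le> a w}"
    by (auto simp: out_sight_def ring_sight_def)
  then have "card {w \<in> out_sight u. r w < r v}
      \<le> card {w \<in> V - {u, v}. r u < r w \<and> r w < r v \<and> a u \<le> a w}"
    using finV by (intro card_mono) auto
  then show "card {w \<in> out_sight u. r w < r v} \<le> k"
    using v by (simp add: out_sight_def ring_sight_def)
qed

text \<open>
  An arc may meet the inward ray twice, once on each side of the origin; \<open>p\<close> is its first
  position on the line, where the origin has coordinate \<open>0\<close> and \<open>u\<close> coordinate \<open>- r u\<close>.
\<close>

lemma card_in_sight: "card (in_sight u) \<le> k + 1"
proof -
  define p where "p w = (if r w < r u \<and> a u \<le> a w then - r w else r w)" for w
  have sub: "in_sight u \<subseteq> V" by (auto simp: in_sight_def)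
  show ?thesis
  proof (rule card_le_Suc_if_few_below[where p = p])
    show "finite (in_sight u)" using finV sub by (rule rev_finite_subset)
    \<comment> \<open>Radii are positive, so the absolute value of \<open>p w\<close> is
      \<open>r w\<close>.\<close>
    have "w = w'" if "w \<in> V" "w' \<in> V" "p w = p w'" for w w'
    proof -
      have "r w = r w'" using that r_pos[of w] r_pos[of w'] by (auto simp: p_def split: if_splits)
      then show ?thesis using inj_r that by (simp add: inj_on_eq_iff)
    qed
    then show "inj_on p (in_sight u)" using sub by (auto intro!: inj_onI)
    fix v assume v: "v \<in> in_sight u"
    show "card {w \<in> in_sight u. p w < p v} \<le> k"
    proof (cases "ring_sight (a u) v u")
      case True
      then have "p v = - r v" by (simp add: p_def ring_sight_def)
      \<comment> \<open>A position below \<open>- r v\<close> is negative, hence on the near side of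
        the origin: \<open>w\<close> lies between \<open>v\<close> and \<open>u\<close>.\<close>
      have "w \<in> {w \<in> V - {v, u}. r v < r w \<and> r w < r u \<and> a u \<le> a w}"
        if "w \<in> in_sight u" "p w < p v" for w
        using that \<open>p v = - r v\<close> r_pos[of w] r_pos[of v] v sub
        by (auto simp: p_def in_sight_def split: if_splits)
      then have "{w \<in> in_sight u. p w < p v}
          \<subseteq> {w \<in> V - {v, u}. r v < r w \<and> r w < r u \<and> a u \<le> a w}"
        by blast
      then have "card {w \<in> in_sight u. p w < p v}
          \<le> card {w \<in> V - {v, u}. r v < r w \<and> r w < r u \<and> a u \<le> a w}"
        using finV by (intro card_mono) auto
      then show ?thesis using True by (simp add: ring_sight_def)
    next
      case False
      let ?B = "{w \<in> V - {u, v}. r w < r u \<and> a u \<le> a w \<or> r w < r v \<and> opposite (a u) \<le> a w}"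
      \<comment> \<open>Here \<open>v\<close> is seen through the origin but may also meet the near
        half of the line, so its position need not be \<open>r v\<close>.\<close>
      have "p v \<le> r v" using r_pos[of v] v sub by (auto simp: p_def)
      have "w \<in> ?B" if "w \<in> in_sight u" "p w < p v" for w
      proof (cases "r w < r u \<and> a u \<le> a w")
        case True
        then show ?thesis using that sub by (auto simp: in_sight_def)
      next
        case outside: False
        then have "r w < r v" using that(2) \<open>p v \<le> r v\<close> by (simp add: p_def split: if_splits)
        \<comment> \<open>Since \<open>w\<close> misses the near half, it can belong to
          \<open>in_sight u\<close> only by being seen through the origin.\<close>
        moreover have "opposite (a u) \<le> a w"
          using outside that(1) by (auto simp: in_sight_def ring_sight_def origin_sight_def)
        ultimately show ?thesis using that by (auto simp: in_sight_def)
      qed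
      then have "{w \<in> in_sight u. p w < p v} \<subseteq> ?B" by blast
      then have "card {w \<in> in_sight u. p w < p v} \<le> card ?B"
        using finV by (intro card_mono) auto
      then show ?thesis using False v by (simp add: in_sight_def origin_sight_def)
    qed
  qed
qed

text \<open>The sight sets are taken in \<open>V\<close> and only then cut down to \<open>W\<close>,
  because dropping arcs could create new visibilities. Strictness, owed to the outermost arc of
  \<open>W\<close>, saves one color.\<close>

lemma sum_sight_less:
  assumes "W \<subseteq> V" "W \<noteq> {}"
  shows "(\<Sum>u\<in>W. card ((in_sight u \<union> out_sight u) \<inter> W)) < (2 * k + 2) * card W"
proof -
  have finW: "finite W" using finV assms(1) by (rule rev_finite_subset)
  have fin: "finite (in_sight u)" "finite (out_sight u)" for u
    using finV by (auto simp: in_sight_def out_sight_def)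
  have le: "card ((in_sight u \<union> out_sight u) \<inter> W) \<le> 2 * k + 2" for u
  proof -
    have "card ((in_sight u \<union> out_sight u) \<inter> W) \<le> card (in_sight u \<union> out_sight u)"
      using fin by (intro card_mono) auto
    also have "\<dots> \<le> card (in_sight u) + card (out_sight u)" by (rule card_Un_le)
    finally show ?thesis using card_in_sight[of u] card_out_sight[of u] by simp
  qed
  have "Max (r ` W) \<in> r ` W" using finW assms(2) by (intro Max_in) auto
  then obtain m where m: "Max (r ` W) = r m" "m \<in> W" by (rule imageE)
  then have "r w \<le> r m" if "w \<in> W" for w
    using Max_ge[of "r ` W" "r w"] finW that by simp
  then have "out_sight m \<inter> W = {}"
    by (force simp: out_sight_def ring_sight_def)
  then have "(in_sight m \<union> out_sight m) \<inter> W \<subseteq> in_sight m" by blast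
  with fin(1) have "card ((in_sight m \<union> out_sight m) \<inter> W) \<le> card (in_sight m)"
    by (rule card_mono)
  also have "\<dots> < 2 * k + 2" using card_in_sight[of m] by simp
  finally have "\<exists>u\<in>W. card ((in_sight u \<union> out_sight u) \<inter> W) < 2 * k + 2"
    using m(2) by blast
  with finW le have "(\<Sum>u\<in>W. card ((in_sight u \<union> out_sight u) \<inter> W)) < (\<Sum>u\<in>W. 2 * k + 2)"
    by (intro sum_strict_mono_ex1) blast+
  also have "\<dots> = (2 * k + 2) * card W" by (simp only: sum_constant mult.commute of_nat_id)
  finally show ?thesis .
qed

end

section \<open>From cones to lines of sight\<close>

lemma cis_eq_imp_eq:
  assumes "cis x = cis y" "0 \<le> x" "x < 2 * pi" "0 \<le> y" "y < 2 * pi"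
  shows "x = y"
proof -
  obtain n :: int where n: "x = y + 2 * pi * n"
    using assms(1) sin_cos_eq_iff[of x y] by (auto simp: complex_eq_iff)
  have "2 * pi * real_of_int n < 2 * pi * 1" "2 * pi * (-1) < 2 * pi * real_of_int n"
    using n assms(2-5) by linarith+
  then have "real_of_int n < 1" "-1 < real_of_int n"
    using mult_less_cancel_left_pos[of "2 * pi"] pi_gt_zero by (simp_all only: mult_pos_pos zero_less_numeral)
  then have "n = 0" by linarith
  then show ?thesis using n by simp
qed

lemma rcis_eq_rcis_pos:
  assumes "rcis r x = rcis s y" "0 < r" "0 < s"
  shows "r = s" "cis x = cis y"
proof -
  show "r = s" using arg_cong[OF assms(1), of cmod] assms(2,3) by simp
  then show "cis x = cis y" using assms by (simp add: rcis_def)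
qed

text \<open>Cone angles are arbitrary reals. This passes to the representative in [0, 2 pi), where
  containment in an arc is a comparison with \<open>pos_angle\<close>.\<close>

lemma arc_points_subset_arcD:
  assumes "arc_points s \<theta>\<^sub>1 \<theta>\<^sub>2 \<subseteq> arc_set A" "\<theta>\<^sub>1 < \<theta>\<^sub>2" "0 < s" "valid_arc A" "neg_angle A = 0"
  obtains \<phi> where "s = radius A" "0 \<le> \<phi>" "\<phi> \<le> pos_angle A" "\<phi> < 2 * pi" "cis \<phi> = cis \<theta>\<^sub>1"
proof -
  have "rcis s \<theta>\<^sub>1 \<in> arc_points s \<theta>\<^sub>1 \<theta>\<^sub>2" using assms(2) by (force simp: arc_points_def)
  then have "rcis s \<theta>\<^sub>1 \<in> arc_points (radius A) 0 (pos_angle A)"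
    using assms(1,5) by (auto simp: arc_set_def)
  then obtain \<phi> where "rcis s \<theta>\<^sub>1 = rcis (radius A) \<phi>" "0 \<le> \<phi>" "\<phi> \<le> pos_angle A"
    by (auto simp: arc_points_def)
  with that assms(3-5) rcis_eq_rcis_pos[of s \<theta>\<^sub>1 "radius A" \<phi>] show thesis
    by (auto simp: valid_arc_def)
qed

text \<open>The point of the arc at angle \<open>\<theta>\<^sub>1\<close> suffices: an arc that
  blocks the bounding ray of a cone meets the cone.\<close>

lemma sector_meets_arc:
  assumes "r\<^sub>1 \<le> radius A" "radius A \<le> r\<^sub>2" "\<theta>\<^sub>1 < \<theta>\<^sub>2" "neg_angle A = 0"
    "0 \<le> \<phi>" "\<phi> \<le> pos_angle A" "cis \<phi> = cis \<theta>\<^sub>1"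
  shows "sector_points r\<^sub>1 r\<^sub>2 \<theta>\<^sub>1 \<theta>\<^sub>2 \<inter> arc_set A \<noteq> {}"
proof -
  have "rcis (radius A) \<theta>\<^sub>1 \<in> sector_points r\<^sub>1 r\<^sub>2 \<theta>\<^sub>1 \<theta>\<^sub>2"
    using assms(1-3) by (force simp: sector_points_def)
  moreover have "rcis (radius A) \<theta>\<^sub>1 = rcis (radius A) \<phi>"
    using assms(7) by (simp add: rcis_def)
  then have "rcis (radius A) \<theta>\<^sub>1 \<in> arc_set A"
    using assms(4-6) by (auto simp: arc_set_def arc_points_def)
  ultimately show ?thesis by blast
qed

section \<open>Lines of sight in a semi-arc representation\<close>

locale semi_arc_rep =
  fixes k :: nat and V :: "'a set" and f :: "'a \<Rightarrow> circ_arc"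
  assumes finite_V: "finite V"
    and valid: "v \<in> V \<Longrightarrow> valid_arc (f v)"
    and neg: "v \<in> V \<Longrightarrow> neg_angle (f v) = 0"
    and disj: "pairwise (\<lambda>u v. disjnt (arc_set (f u)) (arc_set (f v))) V"
begin

sublocale semi_arcs k V "\<lambda>v. radius (f v)" "\<lambda>v. pos_angle (f v)"
proof
  show "finite V" by (rule finite_V)
  show "inj_on (\<lambda>v. radius (f v)) V"
  proof (rule inj_onI, rule ccontr)
    fix u v assume uv: "u \<in> V" "v \<in> V" "radius (f u) = radius (f v)" "u \<noteq> v"
    \<comment> \<open>All arcs begin on the positive x-axis, so two of equal radius would share
      their negative endpoint.\<close>
    have "rcis (radius (f w)) 0 \<in> arc_set (f w)" if "w \<in> V" for w
      unfolding arc_set_def arc_points_def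
      using valid[OF that] neg[OF that] by (intro CollectI exI[of _ 0]) (simp add: valid_arc_def)
    then have "\<not> disjnt (arc_set (f u)) (arc_set (f v))"
      using uv by (metis disjnt_iff)
    then show False using uv disj by (simp add: pairwise_def)
  qed
qed (use valid neg in \<open>auto simp: valid_arc_def\<close>)

text \<open>The bounding ray of the cone at its lower angle, continued through the origin for a
  bow-tie, serves as line of sight. Each arc blocking it also meets the cone, so at most
  \<open>k\<close> arcs besides \<open>u\<close> and \<open>v\<close> do.\<close>

lemma cone_imp_sight:
  assumes "cone C S T" "S \<subseteq> arc_set (f u)" "T \<subseteq> arc_set (f v)" "u \<in> V" "v \<in> V" "u \<noteq> v"
    and card: "card {w \<in> V - {u, v}. C \<inter> arc_set (f w) \<noteq> {}} \<le> k"
  shows "v \<in> in_sight u \<union> out_sight u \<or> u \<in> in_sight v \<union> out_sight v"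
proof -
  have few: "card {w \<in> V - {u, v}. P w} \<le> k"
    if "\<And>w. w \<in> V \<Longrightarrow> P w \<Longrightarrow> C \<inter> arc_set (f w) \<noteq> {}" for P
  proof -
    have "card {w \<in> V - {u, v}. P w} \<le> card {w \<in> V - {u, v}. C \<inter> arc_set (f w) \<noteq> {}}"
      using finite_V that by (intro card_mono) auto
    then show ?thesis using card by simp
  qed
  from assms(1) show ?thesis
  proof cases
    case (annular r\<^sub>1 r\<^sub>2 \<theta>\<^sub>1 \<theta>\<^sub>2)
    obtain \<phi> where \<phi>: "r\<^sub>1 = radius (f u)" "0 \<le> \<phi>" "\<phi> \<le> pos_angle (f u)" "\<phi> < 2 * pi" "cis \<phi> = cis \<theta>\<^sub>1"
    proof (rule arc_points_subset_arcD)
      show "arc_points r\<^sub>1 \<theta>\<^sub>1 \<theta>\<^sub>2 \<subseteq> arc_set (f u)" using annular assms(2) by simp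
    qed (use annular valid neg assms(4) in auto)
    obtain \<psi> where \<psi>: "r\<^sub>2 = radius (f v)" "0 \<le> \<psi>" "\<psi> \<le> pos_angle (f v)" "\<psi> < 2 * pi" "cis \<psi> = cis \<theta>\<^sub>1"
    proof (rule arc_points_subset_arcD)
      show "arc_points r\<^sub>2 \<theta>\<^sub>1 \<theta>\<^sub>2 \<subseteq> arc_set (f v)" using annular assms(3) by simp
    qed (use annular valid neg assms(5) in auto)
    have "\<phi> = \<psi>" using cis_eq_imp_eq[of \<phi> \<psi>] \<phi> \<psi> by simp
    have "C \<inter> arc_set (f w) \<noteq> {}"
      if "w \<in> V" "radius (f u) < radius (f w) \<and> radius (f w) < radius (f v) \<and> \<phi> \<le> pos_angle (f w)" for w
      unfolding annular(1) using that \<phi> \<psi>(1) annular(6) neg[OF that(1)]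
      by (intro sector_meets_arc[where \<phi> = \<phi>]) auto
    then have "card {w \<in> V - {u, v}. radius (f u) < radius (f w) \<and> radius (f w) < radius (f v) \<and>
        \<phi> \<le> pos_angle (f w)} \<le> k"
      by (rule few)
    then have "ring_sight \<phi> u v"
      using \<phi> \<psi> \<open>\<phi> = \<psi>\<close> annular by (simp add: ring_sight_def)
    then show ?thesis using ring_sight_imp assms by blast
  next
    case (bow_tie r\<^sub>1 r\<^sub>2 \<theta>\<^sub>1 \<theta>\<^sub>2)
    obtain \<phi> where \<phi>: "r\<^sub>1 = radius (f u)" "0 \<le> \<phi>" "\<phi> \<le> pos_angle (f u)" "\<phi> < 2 * pi" "cis \<phi> = cis \<theta>\<^sub>1"
    proof (rule arc_points_subset_arcD)
      show "arc_points r\<^sub>1 \<theta>\<^sub>1 \<theta>\<^sub>2 \<subseteq> arc_set (f u)" using bow_tie assms(2) by simp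
    qed (use bow_tie valid neg assms(4) in auto)
    obtain \<psi> where \<psi>: "r\<^sub>2 = radius (f v)" "0 \<le> \<psi>" "\<psi> \<le> pos_angle (f v)" "\<psi> < 2 * pi"
        "cis \<psi> = cis (\<theta>\<^sub>1 + pi)"
    proof (rule arc_points_subset_arcD)
      show "arc_points r\<^sub>2 (\<theta>\<^sub>1 + pi) (\<theta>\<^sub>2 + pi) \<subseteq> arc_set (f v)"
        using bow_tie assms(3) by simp
    qed (use bow_tie valid neg assms(5) in auto)
    have "C \<inter> arc_set (f w) \<noteq> {}" if w: "w \<in> V" and
      near: "radius (f w) < radius (f u) \<and> \<phi> \<le> pos_angle (f w) \<or>
        radius (f w) < radius (f v) \<and> \<psi> \<le> pos_angle (f w)" for w
    proof -
      have "0 \<le> radius (f w)" using r_pos[OF w] by simp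
      then have "sector_points 0 r\<^sub>1 \<theta>\<^sub>1 \<theta>\<^sub>2 \<inter> arc_set (f w) \<noteq> {} \<or>
          sector_points 0 r\<^sub>2 (\<theta>\<^sub>1 + pi) (\<theta>\<^sub>2 + pi) \<inter> arc_set (f w) \<noteq> {}"
        using near \<phi> \<psi> bow_tie neg[OF w]
          sector_meets_arc[of 0 "f w" r\<^sub>1 \<theta>\<^sub>1 \<theta>\<^sub>2 \<phi>]
          sector_meets_arc[of 0 "f w" r\<^sub>2 "\<theta>\<^sub>1 + pi" "\<theta>\<^sub>2 + pi" \<psi>] by auto
      then show ?thesis unfolding bow_tie(1) by blast
    qed
    then have "card {w \<in> V - {u, v}. radius (f w) < radius (f u) \<and> \<phi> \<le> pos_angle (f w) \<or>
        radius (f w) < radius (f v) \<and> \<psi> \<le> pos_angle (f w)} \<le> k"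
      by (rule few)
    then have os: "origin_sight \<phi> \<psi> u v"
      using \<phi> \<psi> by (simp add: origin_sight_def)
    have cis_\<psi>: "cis \<psi> = - cis \<phi>" using \<phi> \<psi> by (simp add: complex_eq_iff)
    \<comment> \<open>Within [0, 2 pi) the opposite direction is \<open>\<phi> + pi\<close> or
      \<open>\<phi> - pi\<close>; in the latter case \<open>u\<close> and \<open>v\<close> swap
      roles so that the smaller angle comes first.\<close>
    show ?thesis
    proof (cases "\<phi> < pi")
      case True
      have "\<psi> = \<phi> + pi"
        using cis_eq_imp_eq[of \<psi> "\<phi> + pi"] cis_\<psi> \<phi> \<psi> True by (simp add: complex_eq_iff)
      then show ?thesis using origin_sight_imp[of u v \<phi>] os assms \<phi> by blast
    next
      case False
      have "\<psi> = \<phi> - pi"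
        using cis_eq_imp_eq[of \<psi> "\<phi> - pi"] cis_\<psi> \<phi> \<psi> False by (simp add: complex_eq_iff)
      then show ?thesis
        using origin_sight_imp[of v u \<psi>] os assms \<psi> origin_sight_commute[of \<phi> \<psi> u v] by auto
    qed
  qed
qed

lemma k_visible_imp_sight:
  assumes "k_visible k V f u v" "u \<in> V" "v \<in> V" "u \<noteq> v"
  shows "v \<in> in_sight u \<union> out_sight u \<or> u \<in> in_sight v \<union> out_sight v"
proof -
  obtain C S T where C: "cone C S T"
    and ends: "S \<subseteq> arc_set (f u) \<and> T \<subseteq> arc_set (f v) \<or> S \<subseteq> arc_set (f v) \<and> T \<subseteq> arc_set (f u)"
    and card: "card {w \<in> V - {u, v}. C \<inter> arc_set (f w) \<noteq> {}} \<le> k"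
    using assms(1) by (auto simp: k_visible_def)
  from ends show ?thesis
  proof
    assume "S \<subseteq> arc_set (f u) \<and> T \<subseteq> arc_set (f v)"
    then show ?thesis using cone_imp_sight[OF C] card assms by blast
  next
    assume "S \<subseteq> arc_set (f v) \<and> T \<subseteq> arc_set (f u)"
    then show ?thesis
      using cone_imp_sight[OF C, of v u] card assms by (auto simp: insert_commute)
  qed
qed

text \<open>The orientation sends \<open>u\<close> to
  \<open>in_sight u \<union> out_sight u\<close>, so the counting lemma applies with
  \<open>d = 2 * k + 2\<close>.\<close>

lemma ex_low_degree:
  assumes "W \<subseteq> V" "W \<noteq> {}"
    and "\<And>u v. u \<in> W \<Longrightarrow> v \<in> W \<Longrightarrow> R u v \<Longrightarrow> u \<noteq> v \<and> k_visible k V f u v"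
  shows "\<exists>u\<in>W. card {v \<in> W. R u v} < 4 * k + 4"
proof -
  have "\<exists>u\<in>W. card {v \<in> W. R u v} < 2 * (2 * k + 2)"
  proof (rule sparse_orientation_low_degree[OF _ sum_sight_less[OF assms(1,2)]])
    show "finite W" using finite_V assms(1) by (rule rev_finite_subset)
  next
    fix u v assume "u \<in> W" "v \<in> W" "R u v"
    then show "v \<in> in_sight u \<union> out_sight u \<or> u \<in> in_sight v \<union> out_sight v"
      using assms(1,3) by (intro k_visible_imp_sight) auto
  qed
  moreover have "2 * (2 * k + 2) = 4 * k + 4" by simp
  ultimately show ?thesis by (simp only:)
qed

end

theorem corollary14:
  fixes k :: nat and G :: "'a pair_pre_digraph"
  assumes "semi_arc_visibility_graph k G"
  shows "chromatic_number G \<le> 4 * k + 4"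
proof -
  from assms obtain f where f: "arc_visibility_rep k G f" "\<forall>v\<in>pverts G. neg_angle (f v) = 0"
    and "pair_graph G"
    unfolding semi_arc_visibility_graph_def arc_visibility_graph_def by blast
  then interpret pair_graph G by simp
  interpret semi_arc_rep k "pverts G" f
    using f pair_finite_verts by unfold_locales (auto simp: arc_visibility_rep_def)
  have sym: "(v, u) \<in> parcs G" if "(u, v) \<in> parcs G" for u v
    using that arcs_symmetric by simp
  have vis: "u \<noteq> v \<and> k_visible k (pverts G) f u v" if "(u, v) \<in> parcs G" for u v
    using that f(1) in_arcsD1[OF that] in_arcsD2[OF that] pair_no_loops[OF that]
    by (auto simp: arc_visibility_rep_def)
  have "\<exists>u\<in>W. card {v \<in> W. (u, v) \<in> parcs G} < 4 * k + 4"
    if "W \<subseteq> pverts G" "W \<noteq> {}" for W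
    using that vis by (rule ex_low_degree)
  with pair_finite_verts sym obtain c :: "'a \<Rightarrow> nat" where c: "\<forall>v\<in>pverts G. c v < 4 * k + 4"
    "\<forall>u\<in>pverts G. \<forall>v\<in>pverts G. u \<noteq> v \<longrightarrow> (u, v) \<in> parcs G \<longrightarrow> c u \<noteq> c v"
    using degenerate_coloring[of "pverts G" "\<lambda>u v. (u, v) \<in> parcs G" "4 * k + 4"] by blast
  \<comment> \<open>The absence of loops removes the proviso \<open>u \<noteq> v\<close> of the
    coloring lemma.\<close>
  have "c u \<noteq> c v" if "(u, v) \<in> parcs G" for u v
    using c(2) vis[OF that] in_arcsD1[OF that] in_arcsD2[OF that] that by blast
  then have "proper_coloring G (4 * k + 4) c"
    using c(1) by (auto simp: proper_coloring_def)
  then show ?thesis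
    unfolding chromatic_number_def by (intro Least_le) blast
qed

end
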